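(* Let $N>0$ be an integer, let $0 \leqslant n_0 < \cdots < n_{N-1} < M$ be real numbers and let $c_{n_0}, \dots, c_{n_{N-1}} > 0$ be real scalars. Assume that each $n_i$ ($0 \leqslant i \leqslant N-1$) is either a non-negative integer, or is greater than $N-2$ (or both). Let $I \subset [0,+\infty)$ be a bounded domain. Then for sufficiently large $t$ (i.e. there is a real $t_0$ such that for all $t \geqslant t_0$), the function $$x \mapsto t (c_{n_0} x^{n_0} + \cdots + c_{n_{N-1}} x^{n_{N-1}}) - x^{M}$$ is entrywise positivity preserving on $\mathbb{P}_N(I)$.
   Context: For $I \subset \mathbb{C}$, $\mathbb{P}_N(I)$ denotes the set of positive semidefinite Hermitian $N\times N$ matrices all of whose entries lie in $I$. For a function $f$ on $I$ and $A=(a_{jk})$ with entries in $I$, $f[A] := (f(a_{jk}))$ is the entrywise application. The function $f$ is entrywise positivity preserving on $\mathbb{P}_N(I)$ if $f[A]$ is positive semidefinite for every $A \in \mathbb{P}_N(I)$. Convention: $0^0=1$. *)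

theory Defs
  imports "HOL-Analysis.Complex_Transcendental" "Jordan_Normal_Form.Schur_Decomposition"
begin

(* The order on complex is the one of Complex_Order: "0 \<le> z" says that z is real and
   nonnegative.  The scalar product is v* A v, as \<bullet>c conjugates its right argument. *)
definition psd_mat :: "complex mat \<Rightarrow> bool" where
  "psd_mat A \<longleftrightarrow> mat_adjoint A = A \<and>
     (\<forall>v \<in> carrier_vec (dim_row A). 0 \<le> (A *\<^sub>v v) \<bullet>c v)"

definition psd_mats :: "nat \<Rightarrow> complex set \<Rightarrow> complex mat set" where
  "psd_mats N I = {A \<in> carrier_mat N N. psd_mat A \<and> elements_mat A \<subseteq> I}"

(* Functions on I are represented by total functions; only their values on I matter. *)
definition entrywise_positivity_preserving ::
    "nat \<Rightarrow> complex set \<Rightarrow> (complex \<Rightarrow> complex) \<Rightarrow> bool" where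
  "entrywise_positivity_preserving N I f \<longleftrightarrow> (\<forall>A \<in> psd_mats N I. psd_mat (map_mat f A))"

(* Real powers with the convention 0^0 = 1; the library has 0 powr 0 = 0.  For z in [0,\<infinity>)
   this is the usual nonnegative real power, in particular 0^a = 0 for a > 0. *)
definition cpow :: "complex \<Rightarrow> real \<Rightarrow> complex" where
  "cpow z a = (if a = 0 then 1 else z powr complex_of_real a)"

end

theory Submission
  imports Defs
begin

text \<open>A Hermitian matrix with entries in $[0,R]$ is real symmetric, so everything happens over the reals.
Write $f_t(x) = t \sum_s c_s x^s - x^M$, where $s$ runs over a set $S$ of $N$ exponents.

On a rank one matrix, $f_t$ gives $t \sum_s c_s p_s p_s^T - p_M p_M^T$, where $p_s$ is the vector of
the numbers $w_i^s$. For large $t$ this is positive semidefinite as soon as $p_M$ is a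
combination $\sum_s d_s p_s$ whose coefficients are bounded independently of $w$
(\<open>rank_one_domination\<close>). In other words, $x^M$ has to be interpolated by powers $x^s$
at $N$ nodes of $[0,R]$, with coefficients that stay bounded when nodes collide or approach $0$. The
reason (\<open>coefficient_bound\<close>) is Rolle's theorem: divide the error $x^M - \sum_s d_s x^s$ by
its lowest power and differentiate. One power disappears, one zero is lost, and a combination of the
same shape remains, so the other coefficients are bounded by induction. The lowest one is then
read off at any node. The same argument shows that the powers are linearly independent on any $N$
positive nodes, so that the interpolant exists.

The passage from rank one to all matrices (\<open>preserves_psd_Suc\<close>) goes back to FitzGerald
and Horn. If $w$ is a column of $A$ divided by the square root of its diagonal entry, then
$D = A - w w^T$ is positive semidefinite and has a zero row and column. Along the segment from $w w^T$
to $A$ the entrywise image under $f$ moves in the direction $D \circ f'[\cdot]$. By the Schur product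
theorem this is positive semidefinite if $f'$ preserves positivity in dimension $N - 1$.

Now induct on $N$ (\<open>real_domination\<close>). In the derivative of $f_t$, the powers other
than the lowest one form, up to the factor $M$, a function of the same kind with $N - 1$
exponents $s - 1$. What is left over is a nonnegative multiple of a single power, which preserves
positivity in dimension $N - 1$ because its exponent is a natural number (Schur product) or
exceeds $N - 3$ (\<open>preserves_psd_rpow\<close>, where the same segment argument lowers the dimension). This is where the
hypothesis on the exponents enters.\<close>

section \<open>Interpolation by real powers with uniformly bounded coefficients\<close>

text \<open>Between consecutive zeros of $f$ lies a zero of $g = f'$. Recording that the new zeros lie below
some old zero keeps them in any interval $(0,R]$ that contains the old ones, and makes the
induction on the largest zero work.\<close>
lemma rolle_zeros:
  fixes f g :: "real \<Rightarrow> real"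
  assumes der: "\<And>x. 0 < x \<Longrightarrow> (f has_real_derivative g x) (at x)"
    and "finite U" "U \<subseteq> {0<..}" "\<forall>u\<in>U. f u = 0"
  shows "\<exists>V. finite V \<and> V \<subseteq> {0<..} \<and> (\<forall>v\<in>V. g v = 0 \<and> (\<exists>u\<in>U. v < u)) \<and> card U \<le> Suc (card V)"
  using assms(2-4)
proof (induction U rule: finite_linorder_max_induct)
  case empty
  show ?case by (rule exI[of _ "{}"]) simp
next
  case (insert b A)
  show ?case
  proof (cases "A = {}")
    case True
    then show ?thesis by (intro exI[of _ "{}"]) simp
  next
    case False
    from insert obtain V where V: "finite V" "V \<subseteq> {0<..}"
        "\<forall>v\<in>V. g v = 0 \<and> (\<exists>u\<in>A. v < u)" "card A \<le> Suc (card V)"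
      by auto
    define m where "m = Max A"
    have m: "m \<in> A" "\<And>a. a \<in> A \<Longrightarrow> a \<le> m"
      using insert.hyps(1) False by (auto simp: m_def)
    have "m < b" "0 < m" "f m = f b" using m insert by auto
    have "\<exists>z>m. z < b \<and> DERIV f z :> 0"
    proof (rule Rolle)
      show "continuous_on {m..b} f"
        using \<open>0 < m\<close> by (intro DERIV_continuous_on[where D = g])
          (auto intro!: DERIV_subset[OF der] has_field_derivative_at_within der)
      show "f differentiable (at x)" if "m < x" "x < b" for x
        using der[of x] that \<open>0 < m\<close> by (auto simp: real_differentiable_def)
    qed fact+
    then obtain z where z: "m < z" "z < b" "DERIV f z :> 0" by auto
    have "g z = 0" using DERIV_unique[OF der z(3)] z \<open>0 < m\<close> by auto
    have "z \<notin> V" using V(3) m(2) z(1) by fastforce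
    have "b \<notin> A" using insert.hyps by auto
    show ?thesis
    proof (intro exI[of _ "insert z V"] conjI)
      show "card (insert b A) \<le> Suc (card (insert z V))"
        using \<open>z \<notin> V\<close> \<open>b \<notin> A\<close> V insert.hyps by simp
    qed (use V z \<open>g z = 0\<close> \<open>0 < m\<close> in auto)
  qed
qed

text \<open>A factor $e$ on the dominated power makes the bound homogeneous: $e = 1$ bounds interpolation
coefficients, and $e = 0$ gives linear independence. The induction removes the smallest
exponent $b$, by dividing by $x^b$ and differentiating; the rescaling by $M - b$ and $s - b$ in the
bounds comes from this derivative.\<close>
lemma coefficient_bound:
  fixes S :: "real set"
  assumes "finite S" "\<forall>s\<in>S. s < M" "0 < R"
  shows "\<exists>B\<ge>0. \<forall>e d U. finite U \<longrightarrow> U \<subseteq> {0<..R} \<longrightarrow> card S \<le> card U \<longrightarrow>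
    (\<forall>u\<in>U. e * u powr M = (\<Sum>s\<in>S. d s * u powr s)) \<longrightarrow> (\<forall>s\<in>S. \<bar>d s\<bar> \<le> B * \<bar>e\<bar>)"
  using assms(1,2)
proof (induction S rule: finite_linorder_min_induct)
  case empty
  show ?case by (rule exI[of _ 0]) simp
next
  case (insert b S)
  then have "\<forall>s\<in>S. s < M" by simp
  from insert.IH[OF this] obtain B where B0: "B \<ge> 0" and
    B: "\<forall>e d U. finite U \<longrightarrow> U \<subseteq> {0<..R} \<longrightarrow> card S \<le> card U \<longrightarrow>
      (\<forall>u\<in>U. e * u powr M = (\<Sum>s\<in>S. d s * u powr s)) \<longrightarrow> (\<forall>s\<in>S. \<bar>d s\<bar> \<le> B * \<bar>e\<bar>)"
    by (elim exE conjE) (rule that)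
  have bM: "b < M" and sb: "\<And>s. s \<in> S \<Longrightarrow> b < s" and bS: "b \<notin> S" using insert by auto
  define B1 where "B1 s = B * (M - b) / (s - b)" for s
  define B2 where "B2 = R powr (M - b) + (\<Sum>s\<in>S. B1 s * R powr (s - b))"
  have B1: "B1 s \<ge> 0" if "s \<in> S" for s using B0 bM sb[OF that] by (simp add: B1_def)
  have B2: "B2 \<ge> 0" unfolding B2_def by (intro add_nonneg_nonneg sum_nonneg) (use B1 in auto)
  show ?case
  proof (intro exI[of _ "B2 + sum B1 S"] conjI allI impI ballI)
    show "0 \<le> B2 + sum B1 S" using B2 B1 by (simp add: sum_nonneg)
    fix e d U s
    assume U: "finite U" "U \<subseteq> {0<..R}" "card (insert b S) \<le> card U"
      and eq: "\<forall>u\<in>U. e * u powr M = (\<Sum>s\<in>insert b S. d s * u powr s)"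
      and s: "s \<in> insert b S"
    define f where "f x = e * x powr (M - b) - d b - (\<Sum>s\<in>S. d s * x powr (s - b))" for x
    define g where "g x = e * ((M - b) * x powr (M - b - 1))
        - (\<Sum>s\<in>S. d s * ((s - b) * x powr (s - b - 1)))" for x
    have f0: "f u = 0" if "u \<in> U" for u
    proof -
      have u: "u > 0" using that U by auto
      have "f u = u powr (- b) * (e * u powr M - (\<Sum>s\<in>insert b S. d s * u powr s))"
        using bS insert.hyps(1) u
        by (simp add: f_def right_diff_distrib distrib_left sum_distrib_left powr_diff powr_minus field_simps)
      then show ?thesis using eq that by simp
    qed
    have der: "(f has_real_derivative g x) (at x)" if "0 < x" for x
      unfolding f_def[abs_def] g_def using that
      by (auto intro!: derivative_eq_intros has_real_derivative_powr sum.cong simp: mult_ac)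
    \<comment> \<open>The term of exponent $b$ has become the constant $d_b$ and drops out of the derivative $g$.\<close>
    obtain V where V: "finite V" "V \<subseteq> {0<..}" "\<forall>v\<in>V. g v = 0 \<and> (\<exists>u\<in>U. v < u)" "card U \<le> Suc (card V)"
      using rolle_zeros[of f g U] der U f0 by (smt (verit, ccfv_threshold) greaterThanAtMost_iff greaterThan_iff subsetI subset_iff)
    have VR: "V \<subseteq> {0<..R}" using V U by fastforce
    have cV: "card S \<le> card V" using V(4) U(3) bS insert.hyps(1) by simp
    have eqV: "\<forall>u\<in>V. (e * (M - b)) * u powr M = (\<Sum>s\<in>S. (d s * (s - b)) * u powr s)"
    proof
      fix u assume "u \<in> V"
      then have u: "u > 0" and "g u = 0" using V by auto
      have p: "u powr x = u powr (b + 1) * u powr (x - b - 1)" for x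
        using u by (simp flip: powr_add)
      have t: "u powr (b + 1) * (k * ((x - b) * u powr (x - b - 1))) = (k * (x - b)) * u powr x" for k x
        unfolding p[of x] by (simp only: mult_ac)
      have "0 = u powr (b + 1) * g u" using \<open>g u = 0\<close> by simp
      also have "\<dots> = (e * (M - b)) * u powr M - (\<Sum>s\<in>S. (d s * (s - b)) * u powr s)"
        unfolding g_def right_diff_distrib[of "u powr (b + 1)"] sum_distrib_left t ..
      finally show "(e * (M - b)) * u powr M = (\<Sum>s\<in>S. (d s * (s - b)) * u powr s)" by simp
    qed
    have d1: "\<bar>d s\<bar> \<le> B1 s * \<bar>e\<bar>" if "s \<in> S" for s
    proof -
      have "\<bar>d s * (s - b)\<bar> \<le> B * \<bar>e * (M - b)\<bar>"
        using B[rule_format, OF V(1) VR cV eqV[rule_format] that] .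
      moreover have "\<bar>s - b\<bar> = s - b" "\<bar>M - b\<bar> = M - b" using sb[OF that] bM by auto
      ultimately have "\<bar>d s\<bar> * (s - b) \<le> B * (\<bar>e\<bar> * (M - b))" by (simp only: abs_mult)
      then have "\<bar>d s\<bar> \<le> B * (\<bar>e\<bar> * (M - b)) / (s - b)" using sb[OF that] by (simp only: pos_le_divide_eq diff_gt_0_iff_gt)
      then show ?thesis by (simp add: B1_def mult_ac)
    qed
    \<comment> \<open>At one node, all other terms of $f$ are bounded, since $M - b$ and $s - b$ are positive.\<close>
    obtain u where u: "u \<in> U" using U(3) bS insert.hyps(1) by fastforce
    have uR: "0 < u" "u \<le> R" using u U by auto
    have "d b = e * u powr (M - b) - (\<Sum>s\<in>S. d s * u powr (s - b))"
      using f0[OF u] by (simp add: f_def)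
    also have "\<bar>\<dots>\<bar> \<le> \<bar>e * u powr (M - b)\<bar> + \<bar>\<Sum>s\<in>S. d s * u powr (s - b)\<bar>" by simp
    also have "\<dots> \<le> \<bar>e\<bar> * R powr (M - b) + (\<Sum>s\<in>S. B1 s * \<bar>e\<bar> * R powr (s - b))"
    proof (rule add_mono)
      show "\<bar>e * u powr (M - b)\<bar> \<le> \<bar>e\<bar> * R powr (M - b)"
        using uR bM by (auto simp: abs_mult intro!: mult_left_mono powr_mono2)
      show "\<bar>\<Sum>s\<in>S. d s * u powr (s - b)\<bar> \<le> (\<Sum>s\<in>S. B1 s * \<bar>e\<bar> * R powr (s - b))"
      proof (rule order_trans[OF sum_abs], rule sum_mono)
        fix s assume s: "s \<in> S"
        have "u powr (s - b) \<le> R powr (s - b)" using uR sb[OF s] by (intro powr_mono2) auto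
        then show "\<bar>d s * u powr (s - b)\<bar> \<le> B1 s * \<bar>e\<bar> * R powr (s - b)"
          unfolding abs_mult using d1[OF s] B1[OF s] by (intro mult_mono) auto
      qed
    qed
    also have "\<dots> = B2 * \<bar>e\<bar>"
      unfolding B2_def distrib_right sum_distrib_right by (simp only: mult_ac)
    finally have db: "\<bar>d b\<bar> \<le> B2 * \<bar>e\<bar>" .
    show "\<bar>d s\<bar> \<le> (B2 + sum B1 S) * \<bar>e\<bar>"
    proof (cases "s = b")
      case True
      have "B2 * \<bar>e\<bar> \<le> (B2 + sum B1 S) * \<bar>e\<bar>" using B1 by (intro mult_right_mono) (auto simp: sum_nonneg)
      then show ?thesis using db True by simp
    next
      case False
      then have s: "s \<in> S" using \<open>s \<in> insert b S\<close> by simp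
      have "B1 s \<le> sum B1 S" using s insert.hyps(1) B1 by (intro member_le_sum) auto
      then have "B1 s * \<bar>e\<bar> \<le> (B2 + sum B1 S) * \<bar>e\<bar>" using B2 by (intro mult_right_mono) auto
      then show ?thesis using d1[OF s] by simp
    qed
  qed
qed

text \<open>The bound for a dominated power with coefficient $0$; its exponent is arbitrary above $S$.\<close>
lemma powr_combination_zero:
  fixes S U :: "real set"
  assumes "finite S" "finite U" "U \<subseteq> {0<..}" "card S \<le> card U"
    and zero: "\<forall>u\<in>U. (\<Sum>s\<in>S. d s * u powr s) = 0" and "s \<in> S"
  shows "d s = 0"
proof -
  define M R where "M = Max S + 1" and "R = Max (insert 1 U)"
  have "\<forall>s\<in>S. s < M" using assms(1) by (auto simp: M_def intro: le_less_trans[OF Max_ge])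
  have "0 < R" using assms(2) by (auto simp: R_def Max_gr_iff)
  obtain B where
    B: "\<forall>e d U. finite U \<longrightarrow> U \<subseteq> {0<..R} \<longrightarrow> card S \<le> card U \<longrightarrow>
      (\<forall>u\<in>U. e * u powr M = (\<Sum>s\<in>S. d s * u powr s)) \<longrightarrow> (\<forall>s\<in>S. \<bar>d s\<bar> \<le> B * \<bar>e\<bar>)"
    using coefficient_bound[OF assms(1) \<open>\<forall>s\<in>S. s < M\<close> \<open>0 < R\<close>] by (elim exE conjE) (rule that)
  have "U \<subseteq> {0<..R}" using assms(2,3) by (auto simp: R_def)
  from B[rule_format, OF assms(2) this assms(4), of 0 d s] zero \<open>s \<in> S\<close> show ?thesis by simp
qed

text \<open>Newton's scheme: correct the interpolant on the old nodes by a multiple of a combination $E$ that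
vanishes there. $E$ does not vanish at the new node, for otherwise it would be a nontrivial
combination with as many zeros as terms.\<close>
lemma powr_interpolation:
  fixes S U :: "real set" and h :: "real \<Rightarrow> real"
  assumes "finite U" "finite S" "card U = card S" "U \<subseteq> {0<..}"
  shows "\<exists>d. \<forall>u\<in>U. h u = (\<Sum>s\<in>S. d s * u powr s)"
  using assms
proof (induction U arbitrary: S h rule: finite_induct)
  case empty
  then show ?case by simp
next
  case (insert u U)
  then have "S \<noteq> {}" by auto
  then obtain s where s: "s \<in> S" by auto
  define T where "T = S - {s}"
  have T: "finite T" "card U = card T" "S = insert s T" "s \<notin> T"
    using insert s by (auto simp: T_def)
  have Upos: "U \<subseteq> {0<..}" using insert by auto
  obtain d1 where d1: "\<forall>x\<in>U. x powr s = (\<Sum>r\<in>T. d1 r * x powr r)"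
    using insert.IH[OF T(1,2) Upos, of "\<lambda>x. x powr s"] by auto
  obtain d2 where d2: "\<forall>x\<in>U. h x = (\<Sum>r\<in>T. d2 r * x powr r)"
    using insert.IH[OF T(1,2) Upos, of h] by auto
  define E where "E x = x powr s - (\<Sum>r\<in>T. d1 r * x powr r)" for x
  have E0: "E x = 0" if "x \<in> U" for x using d1 that by (simp add: E_def)
  have Esum: "E x = (\<Sum>r\<in>S. (if r = s then 1 else - d1 r) * x powr r)" for x
  proof -
    have "(\<Sum>r\<in>T. (if r = s then 1 else - d1 r) * x powr r) = (\<Sum>r\<in>T. - d1 r * x powr r)"
      using T(4) by (intro sum.cong) auto
    then show ?thesis using T by (simp add: E_def sum_negf)
  qed
  have "E u \<noteq> 0"
  proof
    assume "E u = 0"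
    then have "\<forall>x\<in>insert u U. (\<Sum>r\<in>S. (if r = s then 1 else - d1 r) * x powr r) = 0"
      using E0 Esum by auto
    from powr_combination_zero[OF _ _ _ _ this s] insert show False by auto
  qed
  define l where "l = (h u - (\<Sum>r\<in>T. d2 r * u powr r)) / E u"
  define d where "d r = (if r = s then l else d2 r - l * d1 r)" for r
  have dsum: "(\<Sum>r\<in>S. d r * x powr r) = (\<Sum>r\<in>T. d2 r * x powr r) + l * E x" for x
  proof -
    have "(\<Sum>r\<in>T. d r * x powr r) = (\<Sum>r\<in>T. d2 r * x powr r - l * (d1 r * x powr r))"
      using T(4) by (intro sum.cong) (auto simp: d_def algebra_simps)
    then show ?thesis using T by (simp add: d_def E_def sum_subtractf sum_distrib_left algebra_simps)
  qed
  show ?case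
    by (rule exI[of _ d]) (use dsum E0 d2 \<open>E u \<noteq> 0\<close> in \<open>auto simp: l_def\<close>)
qed

text \<open>Fewer nodes than exponents are allowed: the a priori bound needs a full set, so further nodes are added.\<close>
lemma bounded_powr_interpolation:
  fixes S :: "real set"
  assumes "finite S" "\<forall>s\<in>S. s < M" "0 < R"
  shows "\<exists>B\<ge>0. \<forall>U. finite U \<longrightarrow> U \<subseteq> {0<..R} \<longrightarrow> card U \<le> card S \<longrightarrow>
    (\<exists>d. (\<forall>s\<in>S. \<bar>d s\<bar> \<le> B) \<and> (\<forall>u\<in>U. u powr M = (\<Sum>s\<in>S. d s * u powr s)))"
proof -
  from coefficient_bound[OF assms] obtain B where B0: "B \<ge> 0" and
    B: "\<forall>e d U. finite U \<longrightarrow> U \<subseteq> {0<..R} \<longrightarrow> card S \<le> card U \<longrightarrow>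
      (\<forall>u\<in>U. e * u powr M = (\<Sum>s\<in>S. d s * u powr s)) \<longrightarrow> (\<forall>s\<in>S. \<bar>d s\<bar> \<le> B * \<bar>e\<bar>)"
    by (elim exE conjE) (rule that)
  have "\<exists>d. (\<forall>s\<in>S. \<bar>d s\<bar> \<le> B) \<and> (\<forall>u\<in>U. u powr M = (\<Sum>s\<in>S. d s * u powr s))"
    if U: "finite U" "U \<subseteq> {0<..R}" "card U \<le> card S" for U
  proof -
    have "infinite {0<..R}" using assms(3) by (simp add: infinite_Ioc)
    then have "infinite ({0<..R} - U)" using U by (simp add: Diff_infinite_finite)
    then obtain W where W: "finite W" "card W = card S - card U" "W \<subseteq> {0<..R} - U"
      using infinite_arbitrarily_large by blast
    have "card (U \<union> W) = card S" using W U by (subst card_Un_disjoint) auto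
    have sub: "U \<union> W \<subseteq> {0<..R}" "finite (U \<union> W)" using U W by auto
    then have "U \<union> W \<subseteq> {0<..}" by (auto simp: subset_iff)
    then obtain d where d: "\<forall>u\<in>U \<union> W. u powr M = (\<Sum>s\<in>S. d s * u powr s)"
      using powr_interpolation[of "U \<union> W" S "\<lambda>u. u powr M"] assms(1) sub(2)
        \<open>card (U \<union> W) = card S\<close> by blast
    have "\<bar>d s\<bar> \<le> B" if "s \<in> S" for s
      using B[rule_format, of "U \<union> W" 1 d s] sub d that \<open>card (U \<union> W) = card S\<close> by simp
    then show ?thesis using d by auto
  qed
  then show ?thesis using B0 by blast
qed

text \<open>On $[0,\infty)$ this is the real counterpart of the complex power of the statement, with $0^0 = 1$.\<close>
definition rpow :: "real \<Rightarrow> real \<Rightarrow> real" where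
  "rpow x a = (if a = 0 then 1 else x powr a)"

lemma rpow_nonneg: "0 \<le> rpow x a"
  by (simp add: rpow_def)

lemma rpow_pos: "0 < x \<Longrightarrow> rpow x a = x powr a"
  by (simp add: rpow_def)

lemma rpow_mult: "0 \<le> x \<Longrightarrow> 0 \<le> y \<Longrightarrow> rpow (x * y) a = rpow x a * rpow y a"
  by (simp add: rpow_def powr_mult)

lemma rpow_of_nat: "0 \<le> x \<Longrightarrow> rpow x (of_nat k) = x ^ k"
  by (cases "x = 0") (auto simp: rpow_def powr_realpow)

lemma continuous_on_rpow:
  assumes "0 \<le> a"
  shows "continuous_on {0..} (\<lambda>x. rpow x a)"
proof (cases "a = 0")
  case False
  then have "continuous_on {0..} (\<lambda>x::real. x powr a)"
    using assms by (intro continuous_on_powr') (auto intro!: continuous_intros)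
  then show ?thesis using False by (simp add: rpow_def)
qed (simp add: rpow_def)

lemma has_real_derivative_rpow:
  assumes "0 < x"
  shows "((\<lambda>x. rpow x a) has_real_derivative a * rpow x (a - 1)) (at x)"
proof -
  have "((\<lambda>x. x powr a) has_real_derivative a * rpow x (a - 1)) (at x)"
    using has_real_derivative_powr[OF assms, of a] assms by (simp add: rpow_pos)
  then show ?thesis by (cases "a = 0") (auto simp: rpow_def)
qed

text \<open>The node $0$ needs care. If all exponents are positive, it imposes no condition, as both sides
vanish there. If $0$ is an exponent, it forces the constant term to vanish, and this uses up one
exponent and one node.\<close>
lemma bounded_rpow_interpolation:
  fixes S :: "real set"
  assumes S: "finite S" "\<forall>s\<in>S. 0 \<le> s \<and> s < M" and "0 < R"
  shows "\<exists>B\<ge>0. \<forall>U. finite U \<longrightarrow> U \<subseteq> {0..R} \<longrightarrow> card U \<le> card S \<longrightarrow>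
    (\<exists>d. (\<forall>s\<in>S. \<bar>d s\<bar> \<le> B) \<and> (\<forall>u\<in>U. rpow u M = (\<Sum>s\<in>S. d s * rpow u s)))"
proof -
  have ex: "\<exists>B\<ge>0. \<forall>U. finite U \<longrightarrow> U \<subseteq> {0<..R} \<longrightarrow> card U \<le> card T \<longrightarrow>
    (\<exists>d. (\<forall>s\<in>T. \<bar>d s\<bar> \<le> B) \<and> (\<forall>u\<in>U. rpow u M = (\<Sum>s\<in>T. d s * rpow u s)))"
    if "T \<subseteq> S" for T
  proof -
    have "finite T" "\<forall>s\<in>T. s < M" using S that by (auto intro: finite_subset)
    from bounded_powr_interpolation[OF this \<open>0 < R\<close>] obtain B where B0: "B \<ge> 0" and
      B: "\<forall>U. finite U \<longrightarrow> U \<subseteq> {0<..R} \<longrightarrow> card U \<le> card T \<longrightarrow>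
       (\<exists>d. (\<forall>s\<in>T. \<bar>d s\<bar> \<le> B) \<and> (\<forall>u\<in>U. u powr M = (\<Sum>s\<in>T. d s * u powr s)))"
      by (elim exE conjE) (rule that)
    have "(\<exists>d. (\<forall>s\<in>T. \<bar>d s\<bar> \<le> B) \<and> (\<forall>u\<in>U. rpow u M = (\<Sum>s\<in>T. d s * rpow u s)))"
      if U: "finite U" "U \<subseteq> {0<..R}" "card U \<le> card T" for U
    proof -
      obtain d where "\<forall>s\<in>T. \<bar>d s\<bar> \<le> B" "\<forall>u\<in>U. u powr M = (\<Sum>s\<in>T. d s * u powr s)"
        using B[rule_format, OF U] by auto
      moreover have "\<forall>u\<in>U. 0 < u" using U by auto
      ultimately show ?thesis by (intro exI[of _ d]) (simp add: rpow_pos)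
    qed
    then show ?thesis using B0 by blast
  qed
  obtain B1 where B1: "B1 \<ge> 0" "\<And>U. finite U \<Longrightarrow> U \<subseteq> {0<..R} \<Longrightarrow> card U \<le> card S \<Longrightarrow>
    (\<exists>d. (\<forall>s\<in>S. \<bar>d s\<bar> \<le> B1) \<and> (\<forall>u\<in>U. rpow u M = (\<Sum>s\<in>S. d s * rpow u s)))"
    using ex[of S] by auto
  obtain B2 where B2: "B2 \<ge> 0" "\<And>U. finite U \<Longrightarrow> U \<subseteq> {0<..R} \<Longrightarrow> card U \<le> card (S - {0}) \<Longrightarrow>
    (\<exists>d. (\<forall>s\<in>S - {0}. \<bar>d s\<bar> \<le> B2) \<and> (\<forall>u\<in>U. rpow u M = (\<Sum>s\<in>S - {0}. d s * rpow u s)))"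
    using ex[of "S - {0}"] by auto
  have "\<exists>d. (\<forall>s\<in>S. \<bar>d s\<bar> \<le> B1 + B2) \<and> (\<forall>u\<in>U. rpow u M = (\<Sum>s\<in>S. d s * rpow u s))"
    if U: "finite U" "U \<subseteq> {0..R}" "card U \<le> card S" for U
  proof (cases "0 \<in> U")
    case False
    then have "U \<subseteq> {0<..R}" using U(2) by (auto simp: less_le)
    from B1(2)[OF U(1) this U(3)] obtain d
      where "\<forall>s\<in>S. \<bar>d s\<bar> \<le> B1" "\<forall>u\<in>U. rpow u M = (\<Sum>s\<in>S. d s * rpow u s)" by auto
    then show ?thesis using B2(1) by (intro exI[of _ d]) auto
  next
    case True
    define U' where "U' = U - {0}"
    have U': "finite U'" "U' \<subseteq> {0<..R}" "Suc (card U') = card U" "U = insert 0 U'"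
      using U True card_Suc_Diff1[OF U(1) True] by (auto simp: U'_def less_le simp del: card_Diff_insert)
    then have "S \<noteq> {}" using U(3) by auto
    then have "M > 0" using S by force
    then have M0: "rpow 0 M = 0" by (simp add: rpow_def)
    show ?thesis
    proof (cases "0 \<in> S")
      case False
      then have z: "(\<Sum>s\<in>S. d s * rpow 0 s) = 0" for d :: "real \<Rightarrow> real"
        by (intro sum.neutral) (auto simp: rpow_def)
      have "card U' \<le> card S" using U' U by simp
      from B1(2)[OF U'(1,2) this] obtain d
        where d: "\<forall>s\<in>S. \<bar>d s\<bar> \<le> B1" "\<forall>u\<in>U'. rpow u M = (\<Sum>s\<in>S. d s * rpow u s)" by auto
      show ?thesis using d z[of d] M0 U'(4) B2(1) by (intro exI[of _ d]) auto
    next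
      case 0: True
      have "card U' \<le> card (S - {0})" using U' U(3) S(1) 0 by simp
      from B2(2)[OF U'(1,2) this] obtain d
        where d: "\<forall>s\<in>S-{0}. \<bar>d s\<bar> \<le> B2" "\<forall>u\<in>U'. rpow u M = (\<Sum>s\<in>S-{0}. d s * rpow u s)" by auto
      have s: "(\<Sum>s\<in>S. (d(0 := 0)) s * rpow u s) = (\<Sum>s\<in>S-{0}. d s * rpow u s)" for u
        using S(1) by (intro sum.mono_neutral_cong_right) auto
      have z: "(\<Sum>s\<in>S-{0}. d s * rpow 0 s) = 0"
        by (intro sum.neutral) (auto simp: rpow_def)
      show ?thesis
      proof (rule exI[of _ "d(0 := 0)"], intro conjI)
        show "\<forall>s\<in>S. \<bar>(d(0 := 0)) s\<bar> \<le> B1 + B2" using d(1) B1(1) B2(1) by force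
        show "\<forall>u\<in>U. rpow u M = (\<Sum>s\<in>S. (d(0 := 0)) s * rpow u s)"
          unfolding s using d(2) z M0 U'(4) by auto
      qed
    qed
  qed
  then show ?thesis using B1(1) B2(1) by (intro exI[of _ "B1 + B2"]) auto
qed


section \<open>Real positive semidefinite matrices over a finite index set\<close>

text \<open>Matrices are functions on arbitrary finite index sets, so that deleting a row and a column is just
restriction to a smaller set.\<close>
definition quad_form :: "'a set \<Rightarrow> ('a \<Rightarrow> 'a \<Rightarrow> real) \<Rightarrow> ('a \<Rightarrow> real) \<Rightarrow> real" where
  "quad_form J A v = (\<Sum>i\<in>J. \<Sum>j\<in>J. A i j * v i * v j)"

definition psd_on :: "'a set \<Rightarrow> ('a \<Rightarrow> 'a \<Rightarrow> real) \<Rightarrow> bool" where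
  "psd_on J A \<longleftrightarrow> (\<forall>i\<in>J. \<forall>j\<in>J. A i j = A j i) \<and> (\<forall>v. 0 \<le> quad_form J A v)"

lemma quad_form_cong:
  "(\<And>i j. i \<in> J \<Longrightarrow> j \<in> J \<Longrightarrow> A i j = B i j) \<Longrightarrow> quad_form J A v = quad_form J B v"
  by (simp add: quad_form_def)

lemma psd_on_cong:
  assumes "\<And>i j. i \<in> J \<Longrightarrow> j \<in> J \<Longrightarrow> A i j = B i j"
  shows "psd_on J A \<longleftrightarrow> psd_on J B"
  using quad_form_cong[of J A B, OF assms] assms by (simp add: psd_on_def)

lemma quad_form_restrict:
  assumes "finite J" "K \<subseteq> J" "\<And>i j. i \<in> J \<Longrightarrow> j \<in> J \<Longrightarrow> i \<notin> K \<or> j \<notin> K \<Longrightarrow> A i j * v i * v j = 0"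
  shows "quad_form J A v = quad_form K A v"
proof -
  have "quad_form J A v = (\<Sum>i\<in>K. \<Sum>j\<in>J. A i j * v i * v j)"
    unfolding quad_form_def by (intro sum.mono_neutral_right sum.neutral ballI assms) (use assms in auto)
  also have "\<dots> = quad_form K A v"
    unfolding quad_form_def by (intro sum.cong refl sum.mono_neutral_right ballI assms) (use assms in auto)
  finally show ?thesis .
qed

lemma quad_form_add: "quad_form J (\<lambda>i j. A i j + B i j) v = quad_form J A v + quad_form J B v"
  by (simp add: quad_form_def distrib_right sum.distrib)

lemma quad_form_scale: "quad_form J (\<lambda>i j. r * A i j) v = r * quad_form J A v"
  by (simp add: quad_form_def sum_distrib_left mult_ac)

lemma quad_form_rank_one: "quad_form J (\<lambda>i j. w i * w j) v = (\<Sum>i\<in>J. w i * v i)\<^sup>2"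
  by (simp add: quad_form_def power2_eq_square sum_product mult_ac)

lemma psd_on_rank_one: "psd_on J (\<lambda>i j. w i * w j)"
  by (simp add: psd_on_def quad_form_rank_one)

lemma psd_on_add: "psd_on J A \<Longrightarrow> psd_on J B \<Longrightarrow> psd_on J (\<lambda>i j. A i j + B i j)"
  by (simp add: psd_on_def quad_form_add)

lemma psd_on_scale: "0 \<le> r \<Longrightarrow> psd_on J A \<Longrightarrow> psd_on J (\<lambda>i j. r * A i j)"
  by (simp add: psd_on_def quad_form_scale)

lemma psd_on_singleton: "psd_on {i} A \<longleftrightarrow> 0 \<le> A i i"
proof -
  have "quad_form {i} A v = A i i * (v i)\<^sup>2" for v by (simp add: quad_form_def power2_eq_square)
  then show ?thesis by (auto simp: psd_on_def dest: spec[of _ "\<lambda>_. 1"])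
qed

lemma psd_on_subset:
  assumes "psd_on J A" "K \<subseteq> J" "finite J"
  shows "psd_on K A"
proof -
  have "quad_form J A (\<lambda>i. if i \<in> K then v i else 0) = quad_form K A v" for v
  proof -
    have "quad_form J A (\<lambda>i. if i \<in> K then v i else 0) = quad_form K A (\<lambda>i. if i \<in> K then v i else 0)"
      using assms by (intro quad_form_restrict) auto
    then show ?thesis by (simp add: quad_form_def)
  qed
  then show ?thesis using assms unfolding psd_on_def by (metis subsetD)
qed

lemma psd_on_minor:
  assumes "psd_on J A" "finite J" "i \<in> J" "j \<in> J"
  shows "0 \<le> A i i" "(A i j)\<^sup>2 \<le> A i i * A j j"
proof -
  show dg: "0 \<le> A i i"
    using psd_on_subset[OF assms(1), of "{i}"] assms by (simp add: psd_on_singleton)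
  show "(A i j)\<^sup>2 \<le> A i i * A j j"
  proof (cases "i = j")
    case False
    have sym: "A j i = A i j" using assms by (simp add: psd_on_def)
    have q: "0 \<le> A i i * x\<^sup>2 + 2 * A i j * x * y + A j j * y\<^sup>2" for x y
    proof -
      have "0 \<le> quad_form {i, j} A (\<lambda>l. if l = i then x else y)"
        using psd_on_subset[OF assms(1), of "{i, j}"] assms by (simp add: psd_on_def)
      also have "\<dots> = A i i * x\<^sup>2 + 2 * A i j * x * y + A j j * y\<^sup>2"
        using False sym by (simp add: quad_form_def power2_eq_square algebra_simps)
      finally show ?thesis .
    qed
    show ?thesis
    proof (cases "A i i = 0")
      case True
      have "A i j = 0"
      proof (rule ccontr)
        \<comment> \<open>If $A_{ii} = 0$ and $y = 1$, then the form is affine in $x$, so it takes the value $-1$.\<close>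
        assume "A i j \<noteq> 0"
        then have "A i i * (- (A j j + 1) / (2 * A i j))\<^sup>2
            + 2 * A i j * (- (A j j + 1) / (2 * A i j)) * 1 + A j j * 1\<^sup>2 = - 1"
          using True by (simp add: field_simps)
        with q[of "- (A j j + 1) / (2 * A i j)" 1] show False by linarith
      qed
      then show ?thesis using True by simp
    next
      case False
      have "0 \<le> A i i * (A i i * A j j - (A i j)\<^sup>2)"
        \<comment> \<open>For fixed $y$ the form is smallest at $x = - A_{ij} y / A_{ii}$; clear the denominator.\<close>
        using q[of "- A i j" "A i i"] by (simp add: power2_eq_square algebra_simps)
      then show ?thesis using dg False by (simp add: zero_le_mult_iff)
    qed
  qed (simp add: power2_eq_square)
qed

text \<open>The form of $D$ at $v$ is the minimum of the form of $A$ over all vectors that differ from $v$ only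
at $k$; it is attained at $v_k - r$. If $A_{kk} = 0$, then the whole row vanishes, and so does the
quotient by the convention on division, whence $D = A$.\<close>
lemma schur_complement:
  fixes A :: "'a \<Rightarrow> 'a \<Rightarrow> real"
  assumes A: "psd_on J A" and J: "finite J" "k \<in> J"
  defines "D \<equiv> \<lambda>i j. A i j - A i k * A j k / A k k"
  shows "psd_on J D" "\<And>i. i \<in> J \<Longrightarrow> D i k = 0" "\<And>i. i \<in> J \<Longrightarrow> D k i = 0"
proof -
  have sym: "A i j = A j i" if "i \<in> J" "j \<in> J" for i j using A that by (simp add: psd_on_def)
  show col: "D i k = 0" if "i \<in> J" for i
  proof (cases "A k k = 0")
    case True
    then have "A i k = 0" using psd_on_minor(2)[OF A J(1) that J(2)] by simp
    then show ?thesis by (simp add: D_def)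
  qed (simp add: D_def)
  show "D k i = 0" if "i \<in> J" for i
  proof -
    have "D k i = D i k" unfolding D_def sym[OF that J(2)] by (simp only: mult.commute)
    then show ?thesis using col[OF that] by simp
  qed
  have "0 \<le> quad_form J D v" for v
  proof (cases "A k k = 0")
    case True
    then show ?thesis using A by (simp add: D_def psd_on_def)
  next
    case False
    define p where "p = (\<Sum>i\<in>J. A i k * v i)"
    define r where "r = p / A k k"
    define e where "e i = (if i = k then 1 else 0 :: real)" for i
    have 1: "(\<Sum>i\<in>J. \<Sum>j\<in>J. A i j * v i * e j) = p"
      using J by (simp add: e_def p_def mult_delta_right)
    have 2: "(\<Sum>i\<in>J. \<Sum>j\<in>J. A i j * e i * v j) = p"
      using J sym[OF _ J(2)]
      by (subst sum.swap) (simp add: e_def p_def mult_delta_left mult_delta_right)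
    have 3: "(\<Sum>i\<in>J. \<Sum>j\<in>J. A i j * e i * e j) = A k k"
      using J by (simp add: e_def mult_delta_left mult_delta_right)
    have "quad_form J A (\<lambda>i. v i - r * e i)
        = (\<Sum>i\<in>J. \<Sum>j\<in>J. A i j * v i * v j - r * (A i j * v i * e j)
            - r * (A i j * e i * v j) + r\<^sup>2 * (A i j * e i * e j))"
      unfolding quad_form_def by (intro sum.cong refl) (simp add: algebra_simps power2_eq_square)
    also have "\<dots> = quad_form J A v - r * p - r * p + r\<^sup>2 * A k k"
      unfolding sum.distrib sum_subtractf sum_distrib_left[symmetric] 1 2 3 quad_form_def ..
    also have "\<dots> = quad_form J A v - p\<^sup>2 / A k k"
      using False by (simp add: r_def power2_eq_square)
    also have "p\<^sup>2 / A k k = quad_form J (\<lambda>i j. A i k * A j k / A k k) v"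
      using quad_form_scale[of J "1 / A k k" "\<lambda>i j. A i k * A j k" v]
      by (simp add: quad_form_rank_one p_def)
    also have "quad_form J A v - quad_form J (\<lambda>i j. A i k * A j k / A k k) v = quad_form J D v"
      by (simp add: D_def quad_form_def left_diff_distrib sum_subtractf)
    finally show ?thesis using A unfolding psd_on_def by metis
  qed
  moreover have "D i j = D j i" if "i \<in> J" "j \<in> J" for i j
    using sym[OF that] by (simp add: D_def)
  ultimately show "psd_on J D" by (simp add: psd_on_def)
qed

text \<open>Split $A$ into its rank one part at $k$ and the Schur complement $D$. The rank one part times $B$ is
$B$ with rows and columns rescaled, and $D$ lives on a smaller index set.\<close>
lemma schur_product:
  assumes "finite J" "psd_on J A" "psd_on J B"
  shows "psd_on J (\<lambda>i j. A i j * B i j)"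
  using assms
proof (induction J arbitrary: A rule: finite_induct)
  case empty
  show ?case by (simp add: psd_on_def quad_form_def)
next
  case (insert k J)
  let ?J = "insert k J"
  define D where "D = (\<lambda>i j. A i j - A i k * A j k / A k k)"
  have fin: "finite ?J" using insert by simp
  have D: "psd_on ?J D" "\<And>i. i \<in> ?J \<Longrightarrow> D i k = 0" "\<And>i. i \<in> ?J \<Longrightarrow> D k i = 0"
    unfolding D_def using schur_complement[OF insert.prems(1) fin insertI1] by blast+
  have DB: "psd_on J (\<lambda>i j. D i j * B i j)"
    using insert.IH psd_on_subset[OF D(1)] psd_on_subset[OF insert.prems(2)] fin by blast
  have "0 \<le> quad_form ?J (\<lambda>i j. A i j * B i j) v" for v
  proof -
    have "quad_form ?J (\<lambda>i j. A i j * B i j) v =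
        quad_form ?J (\<lambda>i j. (1 / A k k) * (A i k * A j k * B i j) + D i j * B i j) v"
      by (intro quad_form_cong) (simp add: D_def left_diff_distrib)
    also have "\<dots> = (1 / A k k) * quad_form ?J B (\<lambda>i. A i k * v i)
        + quad_form ?J (\<lambda>i j. D i j * B i j) v"
      unfolding quad_form_add quad_form_scale by (simp add: quad_form_def mult_ac)
    also have "quad_form ?J (\<lambda>i j. D i j * B i j) v = quad_form J (\<lambda>i j. D i j * B i j) v"
    proof (rule quad_form_restrict[OF fin subset_insertI])
      fix i j assume "i \<in> ?J" "j \<in> ?J" "i \<notin> J \<or> j \<notin> J"
      then have "D i j = 0" using D(2)[of i] D(3)[of j] by blast
      then show "D i j * B i j * v i * v j = 0" by simp
    qed
    finally have "quad_form ?J (\<lambda>i j. A i j * B i j) v = (1 / A k k) * quad_form ?J B (\<lambda>i. A i k * v i)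
        + quad_form J (\<lambda>i j. D i j * B i j) v" .
    moreover have "0 \<le> A k k" using psd_on_minor(1)[OF insert.prems(1) fin insertI1 insertI1] .
    moreover have "0 \<le> quad_form J (\<lambda>i j. D i j * B i j) v"
      "0 \<le> quad_form ?J B (\<lambda>i. A i k * v i)"
      using DB insert.prems(2) unfolding psd_on_def by blast+
    ultimately show ?thesis by simp
  qed
  moreover have "A i j * B i j = A j i * B j i" if "i \<in> ?J" "j \<in> ?J" for i j
    using insert.prems that unfolding psd_on_def by metis
  ultimately show ?case unfolding psd_on_def by blast
qed

section \<open>Raising the dimension of entrywise positivity preservers\<close>

text \<open>All index sets of cardinality $N$ are admitted, because the induction on $N$ deletes an arbitrary
index.\<close>
definition preserves_psd :: "nat \<Rightarrow> real \<Rightarrow> (real \<Rightarrow> real) \<Rightarrow> bool" where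
  "preserves_psd N R f \<longleftrightarrow> (\<forall>(J :: nat set) A. finite J \<longrightarrow> card J = N \<longrightarrow> psd_on J A \<longrightarrow>
     (\<forall>i\<in>J. \<forall>j\<in>J. A i j \<in> {0..R}) \<longrightarrow> psd_on J (\<lambda>i j. f (A i j)))"

lemma preserves_psd_cong:
  "(\<And>x. 0 \<le> x \<Longrightarrow> x \<le> R \<Longrightarrow> f x = g x) \<Longrightarrow> preserves_psd N R f \<longleftrightarrow> preserves_psd N R g"
  unfolding preserves_psd_def by (intro all_cong1 imp_cong refl psd_on_cong) auto

lemma preserves_psd_add:
  "preserves_psd N R f \<Longrightarrow> preserves_psd N R g \<Longrightarrow> preserves_psd N R (\<lambda>x. f x + g x)"
  by (simp add: preserves_psd_def psd_on_add)

lemma preserves_psd_scale: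
  "0 \<le> r \<Longrightarrow> preserves_psd N R f \<Longrightarrow> preserves_psd N R (\<lambda>x. r * f x)"
  by (simp add: preserves_psd_def psd_on_scale)

lemma preserves_psd_one:
  assumes "\<And>x. 0 \<le> x \<Longrightarrow> x \<le> R \<Longrightarrow> 0 \<le> f x"
  shows "preserves_psd 1 R f"
  unfolding preserves_psd_def using assms by (auto simp: card_1_singleton_iff psd_on_singleton)

text \<open>Here $g$ is the derivative of $f$ on $(0,\infty)$ only, and $g(0)$ may be any value for which $g$
preserves positivity. The reason is that along the segment from $w w^T$ to $A$ an entry vanishes in the
interior only if it is constantly zero, and then the corresponding entry of $D$ is zero. This covers
functions $f$ such as $\sqrt{x}$ that are not differentiable at $0$.\<close>
lemma preserves_psd_Suc:
  fixes f g :: "real \<Rightarrow> real"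
  assumes cont: "continuous_on {0..} f"
    and der: "\<And>x. 0 < x \<Longrightarrow> (f has_real_derivative g x) (at x)"
    and rank1: "\<And>(J :: nat set) w. finite J \<Longrightarrow> card J = Suc N \<Longrightarrow>
        (\<And>i. i \<in> J \<Longrightarrow> 0 \<le> w i \<and> w i \<le> sqrt R) \<Longrightarrow> psd_on J (\<lambda>i j. f (w i * w j))"
    and g: "preserves_psd N R g"
  shows "preserves_psd (Suc N) R f"
  unfolding preserves_psd_def
proof (intro allI impI)
  fix J :: "nat set" and A
  assume J: "finite J" "card J = Suc N" and A: "psd_on J A" and AR: "\<forall>i\<in>J. \<forall>j\<in>J. A i j \<in> {0..R}"
  from J obtain k where k: "k \<in> J" by fastforce
  define K where "K = J - {k}"
  have K: "finite K" "card K = N" "K \<subseteq> J" using J k by (auto simp: K_def)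
  have akk: "0 \<le> A k k" and R0: "0 \<le> R" using AR k by (auto intro: order_trans)
  define w where "w i = A i k / sqrt (A k k)" for i
  define D where "D = (\<lambda>i j. A i j - A i k * A j k / A k k)"
  have D: "psd_on J D" "\<And>i. i \<in> J \<Longrightarrow> D i k = 0" "\<And>i. i \<in> J \<Longrightarrow> D k i = 0"
    unfolding D_def using schur_complement[OF A J(1) k] by blast+
  have ww: "w i * w j = A i k * A j k / A k k" for i j
    using akk by (simp add: w_def)
  have AD: "A i j = w i * w j + D i j" for i j by (simp add: D_def ww)
  have w0: "0 \<le> w i" if "i \<in> J" for i using AR that k akk by (auto simp: w_def)
  have wR: "w i * w i \<le> R" if "i \<in> J" for i
  proof (cases "A k k = 0")
    case True
    then show ?thesis using R0 by (simp add: ww)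
  next
    case False
    then have "w i * w i \<le> A i i"
      using psd_on_minor(2)[OF A J(1) that k] akk by (simp add: ww power2_eq_square divide_simps)
    also have "A i i \<le> R" using AR that by auto
    finally show ?thesis .
  qed
  have wsq: "w i \<le> sqrt R" if "i \<in> J" for i
    using wR[OF that] by (intro real_le_rsqrt) (simp add: power2_eq_square)
  have wwR: "w i * w j \<le> R" if "i \<in> J" "j \<in> J" for i j
  proof -
    have "w i * w j \<le> sqrt R * sqrt R" using wsq w0 that R0 by (intro mult_mono) auto
    then show ?thesis using R0 by simp
  qed
  define C where "C l i j = w i * w j + l * D i j" for l i j
  have C_conv: "C l i j = (1 - l) * (w i * w j) + l * A i j" for l i j
    by (simp add: C_def AD algebra_simps)
  have CR: "C l i j \<in> {0..R}" if "i \<in> J" "j \<in> J" "0 \<le> l" "l \<le> 1" for i j l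
  proof -
    have "(1 - l) * (w i * w j) + l * A i j \<le> R"
      using wwR[OF that(1,2)] AR that by (intro convex_bound_le) auto
    moreover have "0 \<le> (1 - l) * (w i * w j) + l * A i j"
      using w0[OF that(1)] w0[OF that(2)] AR that by (intro add_nonneg_nonneg mult_nonneg_nonneg) auto
    ultimately show ?thesis by (simp add: C_conv)
  qed
  have "0 \<le> quad_form J (\<lambda>i j. f (A i j)) v" for v
  proof -
    define \<phi> where "\<phi> l = quad_form J (\<lambda>i j. f (C l i j)) v" for l
    have "\<phi> 0 \<le> \<phi> 1"
    proof (rule DERIV_nonneg_imp_increasing_open[of 0 1 \<phi>])
      show "continuous_on {0..1} \<phi>"
        unfolding \<phi>_def[abs_def] quad_form_def
      proof (intro continuous_on_sum continuous_on_mult continuous_on_const)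
        fix i j assume ij: "i \<in> J" "j \<in> J"
        show "continuous_on {0..1} (\<lambda>l. f (C l i j))"
          by (rule continuous_on_compose2[OF cont]) (use CR[OF ij] in \<open>auto simp: C_def intro!: continuous_intros\<close>)
      qed
    next
      fix l :: real assume l: "0 < l" "l < 1"
      \<comment> \<open>Either the entry is constant along the segment, or it is positive in its interior.\<close>
      have "((\<lambda>l. f (C l i j)) has_real_derivative D i j * g (C l i j)) (at l)"
        if ij: "i \<in> J" "j \<in> J" for i j
      proof (cases "D i j = 0")
        case True
        then show ?thesis by (simp add: C_def)
      next
        case False
        then have "w i * w j \<noteq> 0 \<or> A i j \<noteq> 0" using AD[of i j] by auto
        moreover have "0 \<le> w i * w j" "0 \<le> A i j" using w0 ij AR by auto
        ultimately have "0 < C l i j"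
          unfolding C_conv using l by (smt (verit, best) mult_nonneg_nonneg mult_pos_pos)
        from der[OF this] have "((\<lambda>l. f (C l i j)) has_real_derivative g (C l i j) * D i j) (at l)"
          by (rule DERIV_chain2) (auto simp: C_def intro!: derivative_eq_intros)
        then show ?thesis by (simp add: mult.commute)
      qed
      then have "(\<phi> has_real_derivative quad_form J (\<lambda>i j. D i j * g (C l i j)) v) (at l)"
        unfolding \<phi>_def[abs_def] quad_form_def by (intro DERIV_sum DERIV_cmult_right)
      moreover have "0 \<le> quad_form J (\<lambda>i j. D i j * g (C l i j)) v"
      proof -
        have "psd_on K (C l)" unfolding C_def[abs_def]
          using l psd_on_subset[OF D(1) K(3) J(1)]
          by (intro psd_on_add psd_on_rank_one psd_on_scale) auto
        then have "psd_on K (\<lambda>i j. g (C l i j))"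
          using g K CR l unfolding preserves_psd_def by (auto simp: subset_iff)
        then have "psd_on K (\<lambda>i j. D i j * g (C l i j))"
          using schur_product[OF K(1) psd_on_subset[OF D(1) K(3) J(1)]] by blast
        moreover have "quad_form J (\<lambda>i j. D i j * g (C l i j)) v = quad_form K (\<lambda>i j. D i j * g (C l i j)) v"
        proof (rule quad_form_restrict[OF J(1) K(3)])
          fix i j assume "i \<in> J" "j \<in> J" "i \<notin> K \<or> j \<notin> K"
          then have "D i j = 0" using D(2)[of i] D(3)[of j] unfolding K_def by blast
          then show "D i j * g (C l i j) * v i * v j = 0" by simp
        qed
        ultimately show ?thesis by (simp add: psd_on_def)
      qed
      ultimately show "\<exists>y. (\<phi> has_real_derivative y) (at l) \<and> 0 \<le> y" by blast
    qed simp
    moreover have "0 \<le> \<phi> 0"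
      using rank1[OF J, of w] w0 wsq by (simp add: \<phi>_def C_def psd_on_def)
    ultimately show ?thesis by (simp add: \<phi>_def C_def AD)
  qed
  then show "psd_on J (\<lambda>i j. f (A i j))" using A by (simp add: psd_on_def)
qed

lemma preserves_psd_power: "preserves_psd N R (\<lambda>x. x ^ k)"
proof (induction k)
  case 0
  show ?case using psd_on_rank_one[of _ "\<lambda>_. 1"] unfolding preserves_psd_def by auto
next
  case (Suc k)
  then show ?case by (simp add: preserves_psd_def schur_product)
qed

text \<open>For natural exponents this is the Schur product theorem. Otherwise differentiation lowers $s$ and $N$ by
one and thus preserves the condition $s > N - 2$; in dimension one there is nothing to
prove, even for negative exponents.\<close>
lemma preserves_psd_rpow:
  assumes "N \<ge> 1" "s \<in> \<nat> \<or> s > real N - 2"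
  shows "preserves_psd N R (\<lambda>x. rpow x s)"
proof (cases "s \<in> \<nat>")
  case True
  then obtain k where "s = of_nat k" by (auto simp: Nats_def)
  then show ?thesis
    using preserves_psd_power[of N R k] by (subst preserves_psd_cong[of R _ "\<lambda>x. x ^ k"]) (auto simp: rpow_of_nat)
next
  case False
  then have "s > real N - 2" using assms by simp
  with assms(1) show ?thesis
  proof (induction N arbitrary: s rule: nat_induct_at_least)
    case base
    show ?case using preserves_psd_one rpow_nonneg by simp
  next
    case (Suc N)
    show ?case
    proof (rule preserves_psd_Suc)
      show "continuous_on {0..} (\<lambda>x. rpow x s)" using Suc by (intro continuous_on_rpow) auto
      show "((\<lambda>x. rpow x s) has_real_derivative s * rpow x (s - 1)) (at x)" if "0 < x" for x
        using has_real_derivative_rpow[OF that] .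
      show "psd_on J (\<lambda>i j. rpow (w i * w j) s)"
        if "\<And>i. i \<in> J \<Longrightarrow> 0 \<le> w i \<and> w i \<le> sqrt R" for J :: "nat set" and w
        using that psd_on_rank_one[of J "\<lambda>i. rpow (w i) s"]
        by (subst psd_on_cong[of J _ "\<lambda>i j. rpow (w i) s * rpow (w j) s"]) (auto simp: rpow_mult)
      show "preserves_psd N R (\<lambda>x. s * rpow x (s - 1))"
        using Suc by (intro preserves_psd_scale Suc.IH) auto
    qed
  qed
qed

section \<open>Domination of a further power\<close>

lemma quad_form_sum:
  "quad_form J (\<lambda>i j. \<Sum>s\<in>S. A s i j) v = (\<Sum>s\<in>S. quad_form J (A s) v)"
proof -
  have "(\<Sum>s\<in>S. quad_form J (A s) v) = (\<Sum>i\<in>J. \<Sum>s\<in>S. \<Sum>j\<in>J. A s i j * v i * v j)"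
    unfolding quad_form_def by (rule sum.swap)
  also have "\<dots> = (\<Sum>i\<in>J. \<Sum>j\<in>J. \<Sum>s\<in>S. A s i j * v i * v j)"
    by (intro sum.cong refl sum.swap)
  finally show ?thesis by (simp add: quad_form_def sum_distrib_right)
qed

text \<open>In the quadratic form at $v$ the power of exponent $s$ contributes $p_s^2$, where
$p_s = \sum_i w_i^s v_i$. By interpolation $p_M = \sum_s d_s p_s$ with $|d_s| \le B$, and Cauchy-Schwarz gives
$p_M^2 \le |S| \sum_s d_s^2 p_s^2$. So it suffices that $t c_s \ge |S| B^2$ for all $s$; the sum
in the definition of $t_0$ is merely a common upper bound of these thresholds.\<close>
lemma rank_one_domination:
  fixes S :: "real set" and c :: "real \<Rightarrow> real"
  assumes S: "finite S" "\<And>s. s \<in> S \<Longrightarrow> 0 \<le> s \<and> s < M \<and> 0 < c s" and "0 < R"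
  shows "\<exists>t0. \<forall>t\<ge>t0. \<forall>(J :: nat set) w. finite J \<longrightarrow> card J \<le> card S \<longrightarrow> (\<forall>i\<in>J. 0 \<le> w i \<and> w i \<le> R) \<longrightarrow>
    psd_on J (\<lambda>i j. t * (\<Sum>s\<in>S. c s * rpow (w i * w j) s) - rpow (w i * w j) M)"
proof -
  have S': "\<forall>s\<in>S. 0 \<le> s \<and> s < M" using S by auto
  from bounded_rpow_interpolation[OF S(1) S' \<open>0 < R\<close>] obtain B where B0: "0 \<le> B" and
    B: "\<forall>U. finite U \<longrightarrow> U \<subseteq> {0..R} \<longrightarrow> card U \<le> card S \<longrightarrow>
      (\<exists>d. (\<forall>s\<in>S. \<bar>d s\<bar> \<le> B) \<and> (\<forall>u\<in>U. rpow u M = (\<Sum>s\<in>S. d s * rpow u s)))"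
    by (elim exE conjE) (rule that)
  define t0 where "t0 = (\<Sum>s\<in>S. B\<^sup>2 * card S / c s)"
  show ?thesis
  proof (intro exI[of _ t0] allI impI)
    fix t and J :: "nat set" and w
    assume t: "t0 \<le> t" and J: "finite J" "card J \<le> card S" and w: "\<forall>i\<in>J. 0 \<le> w i \<and> w i \<le> R"
    have tc: "B\<^sup>2 * card S \<le> t * c s" if "s \<in> S" for s
    proof -
      have "B\<^sup>2 * card S / c s \<le> t0"
        unfolding t0_def using S that by (intro member_le_sum) (auto simp: less_imp_le)
      then have "B\<^sup>2 * card S / c s \<le> t" using t by simp
      then show ?thesis using S(2)[OF that] by (simp add: pos_divide_le_eq)
    qed
    have "finite (w ` J)" "w ` J \<subseteq> {0..R}" "card (w ` J) \<le> card S"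
      using J w card_image_le[OF J(1), of w] by auto
    from B[rule_format, OF this] obtain d where d: "\<forall>s\<in>S. \<bar>d s\<bar> \<le> B"
      "\<forall>u\<in>w ` J. rpow u M = (\<Sum>s\<in>S. d s * rpow u s)" by blast
    have "0 \<le> quad_form J (\<lambda>i j. t * (\<Sum>s\<in>S. c s * rpow (w i * w j) s) - rpow (w i * w j) M) v" for v
    proof -
      define p where "p s = (\<Sum>i\<in>J. rpow (w i) s * v i)" for s
      have pM: "p M = (\<Sum>s\<in>S. d s * p s)"
      proof -
        have "p M = (\<Sum>i\<in>J. \<Sum>s\<in>S. d s * (rpow (w i) s * v i))"
          unfolding p_def by (intro sum.cong refl) (use d(2) in \<open>simp add: sum_distrib_right mult.assoc\<close>)
        also have "\<dots> = (\<Sum>s\<in>S. d s * p s)"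
          unfolding p_def sum_distrib_left by (rule sum.swap)
        finally show ?thesis .
      qed
      have r: "quad_form J (\<lambda>i j. rpow (w i * w j) s) v = (p s)\<^sup>2" for s
      proof -
        have "quad_form J (\<lambda>i j. rpow (w i * w j) s) v = quad_form J (\<lambda>i j. rpow (w i) s * rpow (w j) s) v"
          by (intro quad_form_cong) (use w in \<open>auto simp: rpow_mult\<close>)
        then show ?thesis by (simp add: quad_form_rank_one p_def)
      qed
      have "quad_form J (\<lambda>i j. t * (\<Sum>s\<in>S. c s * rpow (w i * w j) s) - rpow (w i * w j) M) v
          = quad_form J (\<lambda>i j. t * (\<Sum>s\<in>S. c s * rpow (w i * w j) s) + (-1) * rpow (w i * w j) M) v"
        by simp
      also have "\<dots> = t * (\<Sum>s\<in>S. c s * (p s)\<^sup>2) - (p M)\<^sup>2"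
        unfolding quad_form_add quad_form_scale quad_form_sum r by simp
      finally have eq: "quad_form J (\<lambda>i j. t * (\<Sum>s\<in>S. c s * rpow (w i * w j) s) - rpow (w i * w j) M) v
          = t * (\<Sum>s\<in>S. c s * (p s)\<^sup>2) - (p M)\<^sup>2" .
      have "(p M)\<^sup>2 \<le> (\<Sum>s\<in>S. (d s * p s)\<^sup>2) * card S"
        unfolding pM by (rule sum_squared_le_sum_of_squares)
      also have "\<dots> = (\<Sum>s\<in>S. (d s)\<^sup>2 * card S * (p s)\<^sup>2)"
        by (simp add: sum_distrib_left sum_distrib_right power_mult_distrib mult_ac)
      also have "\<dots> \<le> (\<Sum>s\<in>S. t * c s * (p s)\<^sup>2)"
      proof (rule sum_mono)
        fix s assume s: "s \<in> S"
        have "(d s)\<^sup>2 \<le> B\<^sup>2" using d(1) s B0 by (metis abs_ge_zero power2_abs power_mono)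
        then have "(d s)\<^sup>2 * card S \<le> B\<^sup>2 * card S" by (intro mult_right_mono) auto
        then have "(d s)\<^sup>2 * card S \<le> t * c s" using tc[OF s] by (rule order_trans)
        then show "(d s)\<^sup>2 * card S * (p s)\<^sup>2 \<le> t * c s * (p s)\<^sup>2" by (intro mult_right_mono) auto
      qed
      also have "\<dots> = t * (\<Sum>s\<in>S. c s * (p s)\<^sup>2)" by (simp add: sum_distrib_left mult_ac)
      finally show ?thesis unfolding eq by simp
    qed
    then show "psd_on J (\<lambda>i j. t * (\<Sum>s\<in>S. c s * rpow (w i * w j) s) - rpow (w i * w j) M)"
      by (simp add: psd_on_def mult.commute)
  qed
qed

lemma powr_domination:
  fixes s M a b x R t :: real
  assumes "s < M" "0 < a" "0 \<le> b" "0 < x" "x \<le> R" "b * R powr (M - s) / a \<le> t"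
  shows "b * x powr M \<le> t * (a * x powr s)"
proof -
  have "x powr M = x powr (M - s) * x powr s"
    using powr_add[of x "M - s" s] by simp
  then have "b * x powr M = b * x powr (M - s) * x powr s" by simp
  also have "b * x powr (M - s) \<le> b * R powr (M - s)"
    using assms by (intro mult_left_mono powr_mono2) auto
  also have "\<dots> \<le> t * a" using assms by (simp add: pos_divide_le_eq)
  finally show ?thesis by (simp add: mult_right_mono mult.assoc)
qed

text \<open>The step from dimension one to two is special: there the exponents $s - 1$ may be negative, so
that the induction hypothesis does not apply and the derivative may blow up at $0$. But positivity in
dimension one is an inequality between two powers on $(0,R]$, and the value of the derivative at $0$ may be
replaced by $0$.\<close>
lemma real_domination:
  fixes S :: "real set" and c :: "real \<Rightarrow> real"
  assumes "N \<ge> 1" "finite S" "card S = N" "0 < R"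
    and "\<And>s. s \<in> S \<Longrightarrow> 0 \<le> s \<and> s < M \<and> 0 < c s \<and> (s \<in> \<nat> \<or> s > real N - 2)"
  shows "\<exists>t0. \<forall>t\<ge>t0. preserves_psd N R (\<lambda>x. t * (\<Sum>s\<in>S. c s * rpow x s) - rpow x M)"
  using assms(1-3,5)
proof (induction N arbitrary: S M c rule: nat_induct_at_least)
  case base
  then obtain s where S: "S = {s}" by (auto simp: card_1_singleton_iff)
  then have s: "0 \<le> s" "s < M" "0 < c s" using base.prems(3) by auto
  show ?case
  proof (intro exI[of _ "1 * R powr (M - s) / c s"] allI impI preserves_psd_one)
    fix t x assume t: "1 * R powr (M - s) / c s \<le> t" and x: "0 \<le> x" "x \<le> R"
    show "0 \<le> t * (\<Sum>s\<in>S. c s * rpow x s) - rpow x M"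
    proof (cases "x = 0")
      case True
      have "0 \<le> 1 * R powr (M - s) / c s" using s by simp
      then have "0 \<le> t * (c s * rpow x s)" using t s by (intro mult_nonneg_nonneg rpow_nonneg) linarith+
      then show ?thesis using True s by (simp add: S rpow_def)
    next
      case False
      then show ?thesis
        using powr_domination[OF s(2,3), of 1 x R t] t x s by (simp add: S rpow_pos)
    qed
  qed
next
  case (Suc N)
  let ?F = "\<lambda>t x. t * (\<Sum>s\<in>S. c s * rpow x s) - rpow x M"
  define b where "b = Min S"
  define T where "T = S - {b}"
  have "S \<noteq> {}" using Suc.prems by auto
  then have b: "b \<in> S" using Suc.prems by (simp add: b_def)
  have T: "finite T" "card T = N" "S = insert b T" "b \<notin> T" "T \<subseteq> S"
    using Suc.prems b by (auto simp: T_def)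
  have bT: "b < s" if "s \<in> T" for s
    using that Suc.prems(1) by (auto simp: T_def b_def less_le)
  have b0: "0 \<le> b" "0 < c b" using Suc.prems(3)[OF b] by auto
  have sT: "0 < s" "s < M" "0 < c s" if "s \<in> T" for s
    using Suc.prems(3)[of s] bT[OF that] b0 T(5) that by auto
  have M0: "0 < M" using Suc.prems(3)[OF b] by auto
  define g where "g t x = t * (\<Sum>s\<in>T. c s * (s * rpow x (s - 1))) - M * rpow x (M - 1)" for t x
  define gb where "gb t x = t * (c b * b) * rpow x (b - 1) + g t x" for t x
  have gb_der: "(?F t has_real_derivative gb t x) (at x)" if "0 < x" for t x
  proof -
    have "(?F t has_real_derivative t * (\<Sum>s\<in>S. c s * (s * rpow x (s - 1))) - M * rpow x (M - 1)) (at x)"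
      by (intro DERIV_diff DERIV_cmult DERIV_sum has_real_derivative_rpow that)
    also have "t * (\<Sum>s\<in>S. c s * (s * rpow x (s - 1))) - M * rpow x (M - 1) = gb t x"
      using T by (simp add: gb_def g_def distrib_left mult_ac)
    finally show ?thesis .
  qed
  have "0 < sqrt R" using \<open>0 < R\<close> by simp
  have Sc: "0 \<le> s \<and> s < M \<and> 0 < c s" if "s \<in> S" for s using Suc.prems(3)[OF that] by simp
  from rank_one_domination[where S = S and M = M and c = c, OF Suc.prems(1) _ \<open>0 < sqrt R\<close>] Sc obtain t1 where
    t1: "\<forall>t\<ge>t1. \<forall>(J :: nat set) w. finite J \<longrightarrow> card J \<le> card S \<longrightarrow>
      (\<forall>i\<in>J. 0 \<le> w i \<and> w i \<le> sqrt R) \<longrightarrow> psd_on J (\<lambda>i j. ?F t (w i * w j))"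
    by blast
  have "\<exists>t2. \<forall>t\<ge>t2. \<exists>h. (\<forall>x>0. h x = gb t x) \<and> preserves_psd N R h"
  proof (cases "N = 1")
    case True
    then obtain s where TS: "T = {s}" using T by (auto simp: card_1_singleton_iff)
    then have s: "0 < s" "s < M" "0 < c s" using sT by auto
    show ?thesis
    proof (intro exI[of _ "M * R powr (M - s) / (c s * s)"] allI impI)
      fix t assume t: "M * R powr (M - s) / (c s * s) \<le> t"
      have "0 \<le> M * R powr (M - s) / (c s * s)" using s M0 by simp
      then have t0: "0 \<le> t" using t by simp
      have "0 \<le> gb t x" if x: "0 < x" "x \<le> R" for x
      proof -
        have "M * x powr (M - 1) \<le> t * (c s * s * x powr (s - 1))"
          using powr_domination[of "s - 1" "M - 1" "c s * s" M x R t] s M0 x t by simp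
        moreover have "0 \<le> t * (c b * b) * rpow x (b - 1)"
          using t0 b0 rpow_nonneg by simp
        ultimately show ?thesis using x by (simp add: gb_def g_def TS rpow_pos mult.assoc)
      qed
      then have "preserves_psd 1 R (\<lambda>x. if x = 0 then 0 else gb t x)"
        by (intro preserves_psd_one) auto
      then show "\<exists>h. (\<forall>x>0. h x = gb t x) \<and> preserves_psd N R h"
        using True by (intro exI[of _ "\<lambda>x. if x = 0 then 0 else gb t x"]) auto
    qed
  next
    case False
    then have N2: "N \<ge> 2" using Suc.hyps by simp
    define T' where "T' = (\<lambda>s. s - 1) ` T"
    \<comment> \<open>Shifted exponents; the division by $M$ restores the coefficient one of the power $M - 1$.\<close>
    define c' where "c' s = c (s + 1) * (s + 1) / M" for s
    have inj: "inj_on (\<lambda>s. s - 1) T" by (simp add: inj_on_def)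
    have T': "finite T'" "card T' = N" using T inj by (auto simp: T'_def card_image)
    have "0 \<le> s \<and> s < M - 1 \<and> 0 < c' s \<and> (s \<in> \<nat> \<or> s > real N - 2)" if "s \<in> T'" for s
    proof -
      obtain r where r: "r \<in> T" "s = r - 1" using \<open>s \<in> T'\<close> by (auto simp: T'_def)
      have rr: "r \<in> \<nat> \<or> r > real (Suc N) - 2" using Suc.prems(3) r T(5) by blast
      have "s \<in> \<nat> \<and> 0 \<le> s \<or> s > real N - 2"
      proof (cases "r \<in> \<nat>")
        case True
        then obtain m where m: "r = of_nat m" by (auto simp: Nats_def)
        then have "s = of_nat (m - 1)" using sT(1)[OF r(1)] r(2) by (cases m) auto
        then show ?thesis by simp
      qed (use rr r in auto)
      then show ?thesis using sT[OF r(1)] r M0 N2 by (auto simp: c'_def)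
    qed
    from Suc.IH[OF T' this] obtain t2 where
      t2: "\<forall>t\<ge>t2. preserves_psd N R (\<lambda>x. t * (\<Sum>s\<in>T'. c' s * rpow x s) - rpow x (M - 1))" by blast
    show ?thesis
    proof (intro exI[of _ "max t2 0"] allI impI)
      fix t assume t: "max t2 0 \<le> t"
      have g_eq: "g t x = M * (t * (\<Sum>s\<in>T'. c' s * rpow x s) - rpow x (M - 1))" for x
      proof -
        have "M * (\<Sum>s\<in>T'. c' s * rpow x s) = (\<Sum>s\<in>T. c s * (s * rpow x (s - 1)))"
          using M0 by (simp add: T'_def sum.reindex[OF inj] c'_def sum_distrib_left mult.assoc)
        then show ?thesis by (simp add: g_def right_diff_distrib mult.left_commute)
      qed
      have "preserves_psd N R (g t)"
        unfolding g_eq[abs_def] using M0 t2 t by (intro preserves_psd_scale) auto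
      moreover have "preserves_psd N R (\<lambda>x. t * (c b * b) * rpow x (b - 1))"
      proof (cases "b = 0")
        case True
        then show ?thesis using preserves_psd_scale[OF order_refl preserves_psd_power] by simp
      next
        case False
        have "b - 1 \<in> \<nat> \<or> b - 1 > real N - 2"
        proof (cases "b \<in> \<nat>")
          case True
          then obtain m where m: "b = of_nat m" by (auto simp: Nats_def)
          then have "b - 1 = of_nat (m - 1)" using False by (cases m) auto
          then show ?thesis by simp
        qed (use Suc.prems(3)[OF b] in auto)
        then show ?thesis
          using t b0 Suc.hyps by (intro preserves_psd_scale preserves_psd_rpow) auto
      qed
      ultimately have "preserves_psd N R (gb t)"
        unfolding gb_def[abs_def] by (intro preserves_psd_add)
      then show "\<exists>h. (\<forall>x>0. h x = gb t x) \<and> preserves_psd N R h" by blast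
    qed
  qed
  then obtain t2 where t2: "\<forall>t\<ge>t2. \<exists>h. (\<forall>x>0. h x = gb t x) \<and> preserves_psd N R h" by blast
  show ?case
  proof (intro exI[of _ "max t1 t2"] allI impI)
    fix t assume t: "max t1 t2 \<le> t"
    then obtain h where h: "\<And>x. 0 < x \<Longrightarrow> h x = gb t x" "preserves_psd N R h" using t2 by auto
    show "preserves_psd (Suc N) R (?F t)"
    proof (rule preserves_psd_Suc[OF _ _ _ h(2)])
      show "continuous_on {0..} (?F t)"
        using Suc.prems(3) M0
        by (intro continuous_on_diff continuous_on_mult continuous_on_sum continuous_on_const continuous_on_rpow) auto
      show "(?F t has_real_derivative h x) (at x)" if "0 < x" for x
        using gb_der[OF that] h(1)[OF that] by simp
      show "psd_on J (\<lambda>i j. ?F t (w i * w j))"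
        if "finite J" "card J = Suc N" "\<And>i. i \<in> J \<Longrightarrow> 0 \<le> w i \<and> w i \<le> sqrt R" for J :: "nat set" and w
        by (rule t1[rule_format]) (use that t Suc.prems in auto)
    qed
  qed
qed

section \<open>Passage to complex matrices\<close>

lemma cpow_of_real:
  assumes "0 \<le> x"
  shows "cpow (of_real x) a = of_real (rpow x a)"
  using assms by (simp add: cpow_def rpow_def powr_of_real)

lemma hermitian_form_expand:
  assumes A: "A \<in> carrier_mat N N" and v: "v \<in> carrier_vec N"
  shows "(A *\<^sub>v v) \<bullet>c v = (\<Sum>i<N. \<Sum>j<N. A $$ (i, j) * v $ j * cnj (v $ i))"
proof -
  have "(A *\<^sub>v v) \<bullet>c v = (\<Sum>i<N. (A *\<^sub>v v) $ i * cnj (v $ i))"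
    using A v by (simp add: scalar_prod_def atLeast0LessThan)
  also have "\<dots> = (\<Sum>i<N. (\<Sum>j<N. A $$ (i, j) * v $ j) * cnj (v $ i))"
    using A v by (intro sum.cong refl) (simp add: scalar_prod_def atLeast0LessThan)
  finally show ?thesis by (simp add: sum_distrib_right)
qed

lemma mat_adjoint_index:
  assumes "A \<in> carrier_mat N N" "i < N" "j < N"
  shows "mat_adjoint A $$ (i, j) = cnj (A $$ (j, i))"
  using assms by (simp add: mat_adjoint_def mat_of_rows_def)

text \<open>For $v = x + i y$ the Hermitian form of a real symmetric matrix at $v$ is the sum of the quadratic
forms at $x$ and $y$; the imaginary part cancels by symmetry.\<close>
lemma psd_mat_of_real_iff:
  assumes A: "A \<in> carrier_mat N N"
    and a: "\<And>i j. i < N \<Longrightarrow> j < N \<Longrightarrow> A $$ (i, j) = complex_of_real (a i j)"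
  shows "psd_mat A \<longleftrightarrow> psd_on {..<N} a"
proof
  assume psd: "psd_mat A"
  have "a i j = a j i" if "i < N" "j < N" for i j
  proof -
    have "A $$ (i, j) = cnj (A $$ (j, i))"
      using mat_adjoint_index[OF A that] psd by (simp add: psd_mat_def)
    then show ?thesis using a that by simp
  qed
  moreover have "0 \<le> quad_form {..<N} a v" for v
  proof -
    define u where "u = vec N (\<lambda>i. complex_of_real (v i))"
    have u: "u \<in> carrier_vec N" by (simp add: u_def)
    have "(A *\<^sub>v u) \<bullet>c u = of_real (quad_form {..<N} a v)"
      unfolding hermitian_form_expand[OF A u] quad_form_def of_real_sum
      by (intro sum.cong refl) (simp add: a u_def mult_ac)
    moreover have "0 \<le> (A *\<^sub>v u) \<bullet>c u" using psd A u by (auto simp: psd_mat_def)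
    ultimately show ?thesis by (simp add: less_eq_complex_def)
  qed
  ultimately show "psd_on {..<N} a" by (simp add: psd_on_def)
next
  assume psd: "psd_on {..<N} a"
  have sym: "a i j = a j i" if "i < N" "j < N" for i j
    using psd that unfolding psd_on_def by blast
  have dim: "dim_row A = N" "dim_col A = N" using A by auto
  have "mat_adjoint A = A"
  proof (rule eq_matI)
    show "mat_adjoint A $$ (i, j) = A $$ (i, j)" if "i < dim_row A" "j < dim_col A" for i j
      using that dim mat_adjoint_index[OF A, of i j] a[of i j] a[of j i] sym[of i j] by simp
  qed (simp_all add: mat_adjoint_def dim)
  moreover have "0 \<le> (A *\<^sub>v v) \<bullet>c v" if "v \<in> carrier_vec N" for v
  proof -
    define x y where "x i = Re (v $ i)" and "y i = Im (v $ i)" for i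
    have eq: "(A *\<^sub>v v) \<bullet>c v = (\<Sum>i<N. \<Sum>j<N. of_real (a i j) * v $ j * cnj (v $ i))"
      unfolding hermitian_form_expand[OF A that] by (intro sum.cong refl) (simp add: a)
    have re: "Re ((A *\<^sub>v v) \<bullet>c v) = quad_form {..<N} a x + quad_form {..<N} a y"
      unfolding eq Re_sum quad_form_def sum.distrib[symmetric]
      by (intro sum.cong refl) (simp add: x_def y_def algebra_simps)
    have "Im ((A *\<^sub>v v) \<bullet>c v) = (\<Sum>i<N. \<Sum>j<N. a i j * y j * x i) - (\<Sum>i<N. \<Sum>j<N. a i j * x j * y i)"
      unfolding eq Im_sum sum_subtractf[symmetric]
      by (intro sum.cong refl) (simp add: x_def y_def algebra_simps)
    also have "(\<Sum>i<N. \<Sum>j<N. a i j * x j * y i) = (\<Sum>j<N. \<Sum>i<N. a i j * x j * y i)"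
      by (rule sum.swap)
    also have "\<dots> = (\<Sum>j<N. \<Sum>i<N. a j i * y i * x j)"
    proof (intro sum.cong refl)
      fix i j assume "i \<in> {..<N}" "j \<in> {..<N}"
      then show "a j i * x i * y j = a i j * y j * x i" using sym[of i j] by simp
    qed
    finally have "Im ((A *\<^sub>v v) \<bullet>c v) = 0" by simp
    then show ?thesis using re psd by (simp add: less_eq_complex_def psd_on_def)
  qed
  ultimately show "psd_mat A" by (simp add: psd_mat_def dim)
qed

lemma entrywise_positivity_preserving_of_real:
  assumes f: "preserves_psd N R f" and I: "I \<subseteq> complex_of_real ` {0..R}"
    and F: "\<And>x. 0 \<le> x \<Longrightarrow> F (complex_of_real x) = of_real (f x)"
  shows "entrywise_positivity_preserving N I F"
  unfolding entrywise_positivity_preserving_def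
proof
  fix A assume "A \<in> psd_mats N I"
  then have A: "A \<in> carrier_mat N N" "psd_mat A" "elements_mat A \<subseteq> I" by (auto simp: psd_mats_def)
  define a where "a i j = Re (A $$ (i, j))" for i j
  have aA: "A $$ (i, j) = of_real (a i j)" "a i j \<in> {0..R}" if "i < N" "j < N" for i j
  proof -
    have "A $$ (i, j) \<in> complex_of_real ` {0..R}" 
      using elements_matI[OF A(1) that refl] A(3) I by blast
    then show "A $$ (i, j) = of_real (a i j)" "a i j \<in> {0..R}" by (auto simp: a_def)
  qed
  have "psd_on {..<N} a" using A psd_mat_of_real_iff[OF A(1) aA(1)] by simp
  then have "psd_on {..<N} (\<lambda>i j. f (a i j))"
    using f aA(2) unfolding preserves_psd_def by simp
  moreover have "map_mat F A $$ (i, j) = of_real (f (a i j))" if "i < N" "j < N" for i j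
    using that A(1) aA[OF that] F[of "a i j"] by simp
  ultimately show "psd_mat (map_mat F A)"
    using psd_mat_of_real_iff[of "map_mat F A" N "\<lambda>i j. f (a i j)"] A(1) by simp
qed

theorem theorem5p5:
  fixes N :: nat and n c :: "nat \<Rightarrow> real" and M :: real and I :: "complex set"
  assumes "N > 0"
    and "0 \<le> n 0"
    and "\<And>i j. i < j \<Longrightarrow> j < N \<Longrightarrow> n i < n j"
    and "n (N - 1) < M"
    and "\<And>i. i < N \<Longrightarrow> c i > 0"
    and "\<And>i. i < N \<Longrightarrow> n i \<in> \<nat> \<or> n i > real N - 2"
    and "I \<subseteq> \<real>\<^sub>\<ge>\<^sub>0"
    and "bounded I"
  shows "\<exists>t0 :: real. \<forall>t \<ge> t0. entrywise_positivity_preserving N I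
           (\<lambda>x. of_real t * (\<Sum>i<N. of_real (c i) * cpow x (n i)) - cpow x M)"
proof -
  obtain R where R: "0 < R" "\<And>z. z \<in> I \<Longrightarrow> norm z \<le> R"
    using \<open>bounded I\<close> by (auto simp: bounded_pos)
  have I: "I \<subseteq> complex_of_real ` {0..R}"
  proof
    fix z assume "z \<in> I"
    with assms(7) obtain x where "z = of_real x" "0 \<le> x" by (auto elim: nonneg_Reals_cases)
    with R(2)[OF \<open>z \<in> I\<close>] show "z \<in> complex_of_real ` {0..R}" by auto
  qed
  have inj: "inj_on n {..<N}"
  proof (rule linorder_inj_onI')
    fix i j assume "i \<in> {..<N}" "j \<in> {..<N}" "i < j"
    then have "n i < n j" using assms(3)[of i j] by simp
    then show "n i \<noteq> n j" by simp
  qed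
  define S where "S = n ` {..<N}"
  \<comment> \<open>The coefficients are re-indexed by their exponents, which are distinct.\<close>
  define c' where "c' s = c (the_inv_into {..<N} n s)" for s
  have c': "c' (n i) = c i" if "i < N" for i
    using that by (simp add: c'_def the_inv_into_f_f[OF inj])
  have S: "finite S" "card S = N" by (simp_all add: S_def card_image[OF inj])
  have "0 \<le> s \<and> s < M \<and> 0 < c' s \<and> (s \<in> \<nat> \<or> s > real N - 2)" if "s \<in> S" for s
  proof -
    obtain i where i: "i < N" "s = n i" using \<open>s \<in> S\<close> by (auto simp: S_def)
    have "n 0 \<le> n i" using assms(3)[of 0 i] i by (cases "i = 0") auto
    moreover have "n i \<le> n (N - 1)"
    proof (cases "i < N - 1")
      case True
      then show ?thesis using assms(3)[of i "N - 1"] assms(1) by simp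
    next
      case False
      then have "i = N - 1" using i by simp
      then show ?thesis by simp
    qed
    ultimately show ?thesis using i assms(2,4-6) c' by auto
  qed
  then obtain t0 where
    t0: "\<forall>t\<ge>t0. preserves_psd N R (\<lambda>x. t * (\<Sum>s\<in>S. c' s * rpow x s) - rpow x M)"
    using real_domination[of N S R M c'] S R(1) assms(1) by auto
  show ?thesis
  proof (intro exI[of _ t0] allI impI)
    fix t assume "t0 \<le> t"
    then have "preserves_psd N R (\<lambda>x. t * (\<Sum>s\<in>S. c' s * rpow x s) - rpow x M)" using t0 by blast
    then show "entrywise_positivity_preserving N I
           (\<lambda>x. of_real t * (\<Sum>i<N. of_real (c i) * cpow x (n i)) - cpow x M)"
      by (rule entrywise_positivity_preserving_of_real[OF _ I])
        (simp add: S_def sum.reindex[OF inj] c' cpow_of_real)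
  qed
qed

end
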